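(* Let $\Omega$, the fiber $\Omega_f\subset\Omega$ of radius $a$ with center line $\Gamma$, the averaging operator $\mathcal{R}$, the spaces $V,W_\Gamma,Q_\Gamma$ and the finite element spaces $V_h\subset V$, $W_h\subset W_\Gamma$, $Q_h=W_h$, $\mathbb{V}_h=V_h\times W_h$ be as in the context. Assume that the $L^2$ projection $P_{W_\Gamma}\colon W_\Gamma\to W_h$ is continuous and $H^1$-stable, i.e. there is a positive constant $c_W$ (independent of $h$) such that $\|\nabla_\Gamma(P_{W_\Gamma}w)\|_{L^2(\Gamma)}\le c_W\|\nabla_\Gamma w\|_{L^2(\Gamma)}$ for all $w\in W_\Gamma$. Then there exists a constant $\alpha_7>0$, independent of $h$, such that $$\inf_{0\ne q_h\in W_h}\ \sup_{0\ne(v_h,w_h)\in\mathbb{V}_h}\frac{(q_h,\mathcal{R}v_h-w_h)_\Gamma}{\|(v_h,w_h)\|_{\mathbb{V}}\,\|q_h\|_{Q_\Gamma}}\ \ge\ \alpha_7 .$$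
   Context: $\Omega\subset\mathbb{R}^3$ is a connected, bounded, Lipschitz domain; $\Gamma$ is a one-dimensional curve; for $x\in\Gamma$, $D_a(x)$ is the disk of radius $a$ centered at $x$ and orthogonal to $\Gamma$; the fiber is $\Omega_f=\bigcup_{x\in\Gamma}D_a(x)\subset\Omega$, with non-self-intersecting boundary, and is the image of a straight cylinder $\Omega_a$ of radius $a$ with axis a segment $\Upsilon$ under a diffeomorphism $\Phi$ with $\Phi(\Upsilon)=\Gamma$ and $\Phi(D_a(x))=D_a(\Phi(x))$ for every $x\in\Upsilon$. $\mathcal{R}u(x)=\frac{1}{\pi a^2}\int_{D_a(x)}u\,dD$, $x\in\Gamma$, defines a bounded operator $\mathcal{R}\colon H^1(\Omega_f)^3\to W_\Gamma=H^1(\Gamma)^3$; for $v\in V$, $\mathcal{R}v$ means $\mathcal{R}(v|_{\Omega_f})$. $V=\{v\in H^1(\Omega)^3:v|_{\partial\Omega}=0\}$, $\|v\|_V=\|v\|_{L^2(\Omega)}+\|\nabla v\|_{L^2(\Omega)}$; $\|w\|_{W_\Gamma}=\|w\|_{L^2(\Gamma)}+\|\nabla_\Gamma w\|_{L^2(\Gamma)}$, with $\nabla_\Gamma$ the tangential gradient. $Q_\Gamma=W_\Gamma'$ with the dual norm $\|\cdot\|_{Q_\Gamma}$. $\|(v,w)\|_{\mathbb{V}}=\|v\|_V+\|w\|_{W_\Gamma}$. $V_h\subset V$ and $W_h\subset W_\Gamma$ are finite element spaces on independent regular families of meshes of $\Omega$ and $\Gamma$ (no geometrical error in the meshing), $h$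 being the maximum element diameter. An element $q_h\in Q_h=W_h$ is regarded as an element of $Q_\Gamma$ through the $L^2$ product $(q_h,\cdot)_\Gamma$ on $\Gamma$. *)

theory Defs
  imports "HOL-Analysis.Analysis"
begin

type_synonym vec3 = "real^3"

section \<open>Differentiability classes\<close>

definition C1_on :: "'a::euclidean_space set \<Rightarrow> ('a \<Rightarrow> 'b::real_normed_vector) \<Rightarrow> bool" where
  "C1_on U f \<longleftrightarrow> (\<forall>x\<in>U. f differentiable (at x)) \<and>
     (\<forall>b\<in>Basis. continuous_on U (\<lambda>x. frechet_derivative f (at x) b))"

definition diffeomorphism_on :: "'a::euclidean_space set \<Rightarrow> ('a \<Rightarrow> 'b::euclidean_space) \<Rightarrow> bool" where
  "diffeomorphism_on U f \<longleftrightarrow> open U \<and> open (f ` U) \<and> C1_on U f \<and>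
     (\<exists>g. C1_on (f ` U) g \<and> (\<forall>x\<in>U. g (f x) = x))"

text \<open>Since \<^term>\<open>S\<close> is open below, testing with compactly supported functions of class $C^1$ gives
  the same weak derivatives of locally integrable functions as testing with $C^\infty$ ones
  (by mollification).\<close>

definition test_functions :: "'a::euclidean_space set \<Rightarrow> ('a \<Rightarrow> real) set" where
  "test_functions S = {\<phi>. C1_on UNIV \<phi> \<and> compact (closure {x. \<phi> x \<noteq> 0}) \<and>
     closure {x. \<phi> x \<noteq> 0} \<subseteq> S}"

section \<open>Square integrable functions\<close>

text \<open>Elements of function spaces are represented by Borel measurable functions; two functions
  represent the same element iff they agree almost everywhere.\<close>

definition square_integrable :: "'a measure \<Rightarrow> ('a \<Rightarrow> 'b::euclidean_space) \<Rightarrow> bool" where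
  "square_integrable M f \<longleftrightarrow> f \<in> borel_measurable M \<and> integrable M (\<lambda>x. (norm (f x))\<^sup>2)"

definition l2_norm :: "'a measure \<Rightarrow> ('a \<Rightarrow> 'b::euclidean_space) \<Rightarrow> real" where
  "l2_norm M f = sqrt (LINT x|M. (norm (f x))\<^sup>2)"

definition vol :: "'a::euclidean_space set \<Rightarrow> 'a measure" where
  "vol S = restrict_space lborel S"

text \<open>The \<^term>\<open>k\<close>-dimensional Hausdorff measure, normalised so that it is the usual
  \<^term>\<open>k\<close>-dimensional area on \<^term>\<open>k\<close>-dimensional surfaces. The outer measure is countably additive
  on Borel sets (it is a metric outer measure), so \<^const>\<open>measure_of\<close> does not degenerate.\<close>

definition hausdorff_premeasure :: "nat \<Rightarrow> real \<Rightarrow> 'a::euclidean_space set \<Rightarrow> ennreal" where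
  "hausdorff_premeasure k \<delta> A =
     Inf {(\<Sum>i. ennreal (unit_ball_vol (real k) * (diameter (C i) / 2) ^ k)) | C :: nat \<Rightarrow> 'a set.
            A \<subseteq> (\<Union>i. C i) \<and> (\<forall>i. bounded (C i) \<and> diameter (C i) \<le> \<delta>)}"

definition hausdorff_measure :: "nat \<Rightarrow> 'a::euclidean_space measure" where
  "hausdorff_measure k =
     measure_of UNIV (sets borel) (\<lambda>A. SUP \<delta>\<in>{0<..}. hausdorff_premeasure k \<delta> A)"

definition surface :: "vec3 set \<Rightarrow> vec3 measure" where
  "surface S = restrict_space (hausdorff_measure 2) S"

section \<open>Sobolev spaces on a domain\<close>

text \<open>Locally, up to a choice of axes, the domain is the strict hypograph of a Lipschitz function.
  Only the values of \<^term>\<open>g\<close> on the plane orthogonal to \<^term>\<open>n\<close> matter.\<close>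

definition lipschitz_domain :: "vec3 set \<Rightarrow> bool" where
  "lipschitz_domain \<Omega> \<longleftrightarrow> open \<Omega> \<and>
     (\<forall>x\<in>frontier \<Omega>. \<exists>n r L. \<exists>g :: vec3 \<Rightarrow> real. norm n = 1 \<and> r > 0 \<and> L-lipschitz_on UNIV g \<and>
        \<Omega> \<inter> ball x r = {y \<in> ball x r. y \<bullet> n < g (y - (y \<bullet> n) *\<^sub>R n)})"

text \<open>\<^term>\<open>G x $ i $ j\<close> is the weak partial derivative of \<^term>\<open>v x $ i\<close> in direction \<^term>\<open>j\<close>.
  The norm of \<^typ>\<open>real^3^3\<close> is the Frobenius norm.\<close>

definition is_weak_gradient :: "vec3 set \<Rightarrow> (vec3 \<Rightarrow> vec3) \<Rightarrow> (vec3 \<Rightarrow> real^3^3) \<Rightarrow> bool" where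
  "is_weak_gradient \<Omega> v G \<longleftrightarrow> square_integrable (vol \<Omega>) G \<and>
     (\<forall>\<phi>\<in>test_functions \<Omega>. \<forall>i j.
        (LINT x|vol \<Omega>. v x $ i * frechet_derivative \<phi> (at x) (axis j 1)) =
        - (LINT x|vol \<Omega>. G x $ i $ j * \<phi> x))"

definition H1 :: "vec3 set \<Rightarrow> (vec3 \<Rightarrow> vec3) set" where
  "H1 \<Omega> = {v. square_integrable (vol \<Omega>) v \<and> (\<exists>G. is_weak_gradient \<Omega> v G)}"

text \<open>Weak gradients (and tangential gradients below) are unique up to null sets, so the choice does not influence norms.\<close>

definition weak_gradient :: "vec3 set \<Rightarrow> (vec3 \<Rightarrow> vec3) \<Rightarrow> (vec3 \<Rightarrow> real^3^3)" where
  "weak_gradient \<Omega> v = (SOME G. is_weak_gradient \<Omega> v G)"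

definition H1_norm :: "vec3 set \<Rightarrow> (vec3 \<Rightarrow> vec3) \<Rightarrow> real" where
  "H1_norm \<Omega> v = l2_norm (vol \<Omega>) v + l2_norm (vol \<Omega>) (weak_gradient \<Omega> v)"

text \<open>The graph of the trace operator, which is the continuous extension of
  $\varphi \mapsto \varphi|_{\partial\Omega}$ from functions smooth up to the boundary to $H^1(\Omega)$.\<close>

definition has_trace :: "vec3 set \<Rightarrow> (vec3 \<Rightarrow> vec3) \<Rightarrow> (vec3 \<Rightarrow> vec3) \<Rightarrow> bool" where
  "has_trace \<Omega> v g \<longleftrightarrow> (\<exists>\<phi> :: nat \<Rightarrow> vec3 \<Rightarrow> vec3. (\<forall>n. C1_on UNIV (\<phi> n)) \<and>
     (\<lambda>n. H1_norm \<Omega> (\<lambda>x. \<phi> n x - v x)) \<longlonglongrightarrow> 0 \<and>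
     (\<lambda>n. l2_norm (surface (frontier \<Omega>)) (\<lambda>x. \<phi> n x - g x)) \<longlonglongrightarrow> 0)"

definition V :: "vec3 set \<Rightarrow> (vec3 \<Rightarrow> vec3) set" where
  "V \<Omega> = {v \<in> H1 \<Omega>. has_trace \<Omega> v (\<lambda>_. 0)}"

section \<open>Sobolev space on a curve\<close>

text \<open>A curve without its end points is given by a regular injective parametrisation on the
  open unit interval.\<close>

definition curve :: "(real \<Rightarrow> vec3) \<Rightarrow> vec3 set" where
  "curve \<gamma> = \<gamma> ` {0<..<1}"

definition velocity :: "(real \<Rightarrow> vec3) \<Rightarrow> real \<Rightarrow> vec3" where
  "velocity \<gamma> t = vector_derivative \<gamma> (at t)"

text \<open>Line element: $\int_\Gamma f\,d\Gamma = \int_0^1 f(\gamma(t))\,|\gamma'(t)|\,dt$.\<close>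

definition arclength :: "(real \<Rightarrow> vec3) \<Rightarrow> real measure" where
  "arclength \<gamma> = density (vol {0<..<1}) (\<lambda>t. ennreal (norm (velocity \<gamma> t)))"

definition inner_curve :: "(real \<Rightarrow> vec3) \<Rightarrow> (vec3 \<Rightarrow> vec3) \<Rightarrow> (vec3 \<Rightarrow> vec3) \<Rightarrow> real" where
  "inner_curve \<gamma> q w = (LINT t|arclength \<gamma>. q (\<gamma> t) \<bullet> w (\<gamma> t))"

text \<open>The tangential gradient \<^term>\<open>G\<close> annihilates normal vectors, and the chain rule
  $(w\circ\gamma)' = G(\gamma)\,\gamma'$ holds weakly.\<close>

definition is_tangential_gradient ::
  "(real \<Rightarrow> vec3) \<Rightarrow> (vec3 \<Rightarrow> vec3) \<Rightarrow> (vec3 \<Rightarrow> real^3^3) \<Rightarrow> bool" where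
  "is_tangential_gradient \<gamma> w G \<longleftrightarrow> square_integrable (arclength \<gamma>) (\<lambda>t. G (\<gamma> t)) \<and>
     (\<forall>t\<in>{0<..<1}. \<forall>n. n \<bullet> velocity \<gamma> t = 0 \<longrightarrow> G (\<gamma> t) *v n = 0) \<and>
     (\<forall>\<phi>\<in>test_functions {0<..<1}.
        (LINT t|vol {0<..<1}. deriv \<phi> t *\<^sub>R w (\<gamma> t)) =
        - (LINT t|vol {0<..<1}. \<phi> t *\<^sub>R (G (\<gamma> t) *v velocity \<gamma> t)))"

definition W :: "(real \<Rightarrow> vec3) \<Rightarrow> (vec3 \<Rightarrow> vec3) set" where
  "W \<gamma> = {w. square_integrable (arclength \<gamma>) (\<lambda>t. w (\<gamma> t)) \<and> (\<exists>G. is_tangential_gradient \<gamma> w G)}"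

definition tangential_gradient :: "(real \<Rightarrow> vec3) \<Rightarrow> (vec3 \<Rightarrow> vec3) \<Rightarrow> (vec3 \<Rightarrow> real^3^3)" where
  "tangential_gradient \<gamma> w = (SOME G. is_tangential_gradient \<gamma> w G)"

definition tangential_gradient_norm :: "(real \<Rightarrow> vec3) \<Rightarrow> (vec3 \<Rightarrow> vec3) \<Rightarrow> real" where
  "tangential_gradient_norm \<gamma> w = l2_norm (arclength \<gamma>) (\<lambda>t. tangential_gradient \<gamma> w (\<gamma> t))"

definition W_norm :: "(real \<Rightarrow> vec3) \<Rightarrow> (vec3 \<Rightarrow> vec3) \<Rightarrow> real" where
  "W_norm \<gamma> w = l2_norm (arclength \<gamma>) (\<lambda>t. w (\<gamma> t)) + tangential_gradient_norm \<gamma> w"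

definition zero_on_domain :: "vec3 set \<Rightarrow> (vec3 \<Rightarrow> vec3) \<Rightarrow> bool" where
  "zero_on_domain \<Omega> v \<longleftrightarrow> (AE x in vol \<Omega>. v x = 0)"

definition zero_on_curve :: "(real \<Rightarrow> vec3) \<Rightarrow> (vec3 \<Rightarrow> vec3) \<Rightarrow> bool" where
  "zero_on_curve \<gamma> w \<longleftrightarrow> (AE t in arclength \<gamma>. w (\<gamma> t) = 0)"

definition dual_norm :: "(real \<Rightarrow> vec3) \<Rightarrow> ((vec3 \<Rightarrow> vec3) \<Rightarrow> real) \<Rightarrow> real" where
  "dual_norm \<gamma> f = (SUP w\<in>{w \<in> W \<gamma>. \<not> zero_on_curve \<gamma> w}. \<bar>f w\<bar> / W_norm \<gamma> w)"

definition Q_norm :: "(real \<Rightarrow> vec3) \<Rightarrow> (vec3 \<Rightarrow> vec3) \<Rightarrow> real" where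
  "Q_norm \<gamma> q = dual_norm \<gamma> (inner_curve \<gamma> q)"

section \<open>The fiber\<close>

definition normal_disk :: "(real \<Rightarrow> vec3) \<Rightarrow> real \<Rightarrow> vec3 \<Rightarrow> vec3 set" where
  "normal_disk \<gamma> a x =
     {y. (y - x) \<bullet> velocity \<gamma> (inv_into {0<..<1} \<gamma> x) = 0 \<and> dist y x < a}"

definition tube :: "(real \<Rightarrow> vec3) \<Rightarrow> real \<Rightarrow> vec3 set" where
  "tube \<gamma> a = (\<Union>x\<in>curve \<gamma>. normal_disk \<gamma> a x)"

text \<open>The straight cylinder has the axis from \<^term>\<open>p\<close> to \<^term>\<open>q\<close>. Injectivity of \<^term>\<open>\<Phi>\<close> up to
  the boundary of the cylinder excludes self-intersections of the boundary of the fiber.\<close>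

definition fiber_geometry ::
  "vec3 set \<Rightarrow> real \<Rightarrow> vec3 \<Rightarrow> vec3 \<Rightarrow> (vec3 \<Rightarrow> vec3) \<Rightarrow> (real \<Rightarrow> vec3) \<Rightarrow> bool" where
  "fiber_geometry \<Omega> a p q \<Phi> \<gamma> \<longleftrightarrow> 0 < a \<and> p \<noteq> q \<and> \<gamma> = \<Phi> \<circ> linepath p q \<and>
     (\<exists>U. closure (tube (linepath p q) a) \<subseteq> U \<and> diffeomorphism_on U \<Phi>) \<and>
     (\<forall>x\<in>curve (linepath p q). \<Phi> ` normal_disk (linepath p q) a x = normal_disk \<gamma> a (\<Phi> x)) \<and>
     tube \<gamma> a \<subseteq> \<Omega>"

definition averaging :: "(real \<Rightarrow> vec3) \<Rightarrow> real \<Rightarrow> (vec3 \<Rightarrow> vec3) \<Rightarrow> (vec3 \<Rightarrow> vec3)" where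
  "averaging \<gamma> a u x = (1 / (pi * a\<^sup>2)) *\<^sub>R (LINT y|surface (normal_disk \<gamma> a x). u y)"

definition averaging_bounded :: "(real \<Rightarrow> vec3) \<Rightarrow> real \<Rightarrow> bool" where
  "averaging_bounded \<gamma> a \<longleftrightarrow> (\<exists>C. \<forall>u\<in>H1 (tube \<gamma> a).
     averaging \<gamma> a u \<in> W \<gamma> \<and> W_norm \<gamma> (averaging \<gamma> a u) \<le> C * H1_norm (tube \<gamma> a) u)"

section \<open>Finite element spaces\<close>

text \<open>A mesh is given by the maps from a fixed reference cell \<^term>\<open>K\<close> (an interval, a simplex, a
  cube, ...) onto its possibly curved elements. The elements cover the closed set \<^term>\<open>S\<close>
  exactly, and two distinct elements meet in a common face, possibly empty.\<close>

definition mesh :: "'d::euclidean_space set \<Rightarrow> vec3 set \<Rightarrow> ('d \<Rightarrow> vec3) set \<Rightarrow> bool" where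
  "mesh K S T \<longleftrightarrow> finite T \<and> (\<Union>F\<in>T. F ` K) = S \<and>
     (\<forall>F\<in>T. inj_on F K \<and> (\<exists>U. open U \<and> K \<subseteq> U \<and> C1_on U F)) \<and>
     (\<forall>F\<in>T. \<forall>G\<in>T. F \<noteq> G \<longrightarrow> F ` interior K \<inter> G ` interior K = {} \<and>
        (\<exists>A B. A face_of K \<and> B face_of K \<and> F ` K \<inter> G ` K = F ` A \<and> F ` K \<inter> G ` K = G ` B))"

text \<open>Shape regularity for curved elements: the derivative of an element map and its inverse scale
  like the element diameter and its inverse. For affine maps this is the usual bound on the ratio
  of the diameter to the inball diameter.\<close>

definition regular_mesh_family ::
  "'d::euclidean_space set \<Rightarrow> vec3 set \<Rightarrow> real set \<Rightarrow> (real \<Rightarrow> ('d \<Rightarrow> vec3) set) \<Rightarrow> bool" where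
  "regular_mesh_family K S H T \<longleftrightarrow> polytope K \<and> interior K \<noteq> {} \<and> (\<forall>h\<in>H. mesh K S (T h)) \<and>
     (\<exists>\<sigma>>0. \<forall>h\<in>H. \<forall>F\<in>T h. \<forall>x\<in>K. \<forall>v.
        diameter (F ` K) / \<sigma> * norm v \<le> norm (frechet_derivative F (at x) v) \<and>
        norm (frechet_derivative F (at x) v) \<le> \<sigma> * diameter (F ` K) * norm v)"

definition function_subspace :: "('a \<Rightarrow> 'b::real_vector) set \<Rightarrow> bool" where
  "function_subspace S \<longleftrightarrow> (\<lambda>_. 0) \<in> S \<and> (\<forall>u\<in>S. \<forall>v\<in>S. (\<lambda>x. u x + v x) \<in> S) \<and>
     (\<forall>c. \<forall>u\<in>S. (\<lambda>x. c *\<^sub>R u x) \<in> S)"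

definition polynomial_space :: "('d::euclidean_space \<Rightarrow> vec3) set \<Rightarrow> bool" where
  "polynomial_space P \<longleftrightarrow> (\<exists>B. finite B \<and> (\<forall>b\<in>B. polynomial_function b) \<and>
     P = {\<lambda>x. \<Sum>b\<in>B. c b *\<^sub>R b x | c. True})"

text \<open>A conforming finite element subspace of \<^term>\<open>X\<close>: every member, pulled back to the reference
  cell, belongs to the local polynomial space \<^term>\<open>P\<close>. Being single-valued on common faces, members
  are continuous. Proper subspaces of the full piecewise polynomial space are allowed.\<close>

definition fe_space :: "(vec3 \<Rightarrow> vec3) set \<Rightarrow> 'd::euclidean_space set \<Rightarrow> ('d \<Rightarrow> vec3) set \<Rightarrow>
    ('d \<Rightarrow> vec3) set \<Rightarrow> (vec3 \<Rightarrow> vec3) set \<Rightarrow> bool" where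
  "fe_space X K T P S \<longleftrightarrow> function_subspace S \<and> S \<subseteq> X \<and>
     (\<forall>v\<in>S. \<forall>F\<in>T. \<exists>\<pi>\<in>P. \<forall>x\<in>K. v (F x) = \<pi> x)"

definition mesh_size ::
  "'d::euclidean_space set \<Rightarrow> ('d \<Rightarrow> vec3) set \<Rightarrow> 'e::euclidean_space set \<Rightarrow> ('e \<Rightarrow> vec3) set \<Rightarrow> real" where
  "mesh_size K T K' T' = Max ((\<lambda>F. diameter (F ` K)) ` T \<union> (\<lambda>F. diameter (F ` K')) ` T')"

definition is_L2_projection ::
  "(real \<Rightarrow> vec3) \<Rightarrow> (vec3 \<Rightarrow> vec3) set \<Rightarrow> ((vec3 \<Rightarrow> vec3) \<Rightarrow> (vec3 \<Rightarrow> vec3)) \<Rightarrow> bool" where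
  "is_L2_projection \<gamma> S P \<longleftrightarrow>
     (\<forall>w\<in>W \<gamma>. P w \<in> S \<and> (\<forall>q\<in>S. inner_curve \<gamma> (\<lambda>x. w x - P w x) q = 0))"

end

theory Submission
  imports Defs
begin

text \<open>Take \<open>v\<^sub>h = 0\<close>. Since \<open>q\<^sub>h \<in> W\<^sub>h\<close>, every \<open>w\<close> satisfies \<open>(q\<^sub>h, w) = (q\<^sub>h, P w)\<close>, and the \<open>L\<^sup>2\<close> projection
  increases the norm of \<open>W\<^sub>\<Gamma>\<close> by at most \<open>max 1 c\<^sub>W\<close>; so choosing \<open>w\<^sub>h = \<plusminus> P w\<close> with \<open>w\<close> almost
  attaining the dual norm of \<open>q\<^sub>h\<close> gives the bound. The sign of \<open>w\<^sub>h\<close> has to be adjusted, and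
  homogeneity of the norm of \<open>W\<^sub>\<Gamma>\<close>, being defined with a chosen tangential gradient, rests on the
  uniqueness of tangential gradients, i.e. on the fundamental lemma of the calculus of variations.\<close>

section \<open>Fundamental lemma of the calculus of variations\<close>

text \<open>Squaring removes the kink of \<open>max 0\<close> at the origin: there the difference
  quotient is at most |h| in absolute value. This gives a C1 building block for test
  functions.\<close>

lemma max_0_power2_has_real_derivative:
  "((\<lambda>x::real. (max 0 x)\<^sup>2) has_real_derivative 2 * max 0 x) (at x)"
proof -
  consider "x > 0" | "x < 0" | "x = 0" by linarith
  then show ?thesis
  proof cases
    case 1
    have "((\<lambda>x::real. x\<^sup>2) has_real_derivative 2 * max 0 x) (at x)"
      using 1 by (auto intro!: derivative_eq_intros)
    then show ?thesis
      by (rule has_field_derivative_transform_within_open[of _ _ _ "{0<..}"]) (use 1 in auto)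
  next
    case 2
    have "((\<lambda>x::real. 0) has_real_derivative 2 * max 0 x) (at x)"
      using 2 by (auto intro!: derivative_eq_intros)
    then show ?thesis
      by (rule has_field_derivative_transform_within_open[of _ _ _ "{..<0}"]) (use 2 in auto)
  next
    case 3
    have "((\<lambda>h::real. (max 0 h)\<^sup>2 / h) \<longlongrightarrow> 0) (at 0)"
    proof (rule Lim_null_comparison)
      show "\<forall>\<^sub>F h in at (0::real). norm ((max 0 h)\<^sup>2 / h) \<le> \<bar>h\<bar>"
        by (intro always_eventually) (auto simp: max_def power2_eq_square)
      show "((\<lambda>h::real. \<bar>h\<bar>) \<longlongrightarrow> 0) (at 0)"
        by (intro tendsto_rabs_zero tendsto_ident_at)
    qed
    then show ?thesis
      using 3 by (simp add: DERIV_def)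
  qed
qed

lemma C1_on_real:
  fixes f :: "real \<Rightarrow> real"
  assumes "\<And>x. (f has_real_derivative f' x) (at x)" "continuous_on UNIV f'"
  shows "C1_on UNIV f"
proof -
  have "frechet_derivative f (at x) = (*) (f' x)" for x
    using assms(1)[of x] frechet_derivative_at by (force simp: has_field_derivative_def)
  moreover have "f differentiable (at x)" for x
    using assms(1)[of x] real_differentiable_def by blast
  ultimately show ?thesis
    using assms(2) by (simp add: C1_on_def)
qed

text \<open>For \<open>k > 0\<close> the inner function is positive exactly between \<open>c\<close>
  and \<open>d\<close>. The squashing s / (1 + s) keeps its zeros, confines the values to [0, 1],
  and tends to 1 as \<open>k\<close> grows.\<close>

definition bump :: "real \<Rightarrow> real \<Rightarrow> real \<Rightarrow> real \<Rightarrow> real" where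
  "bump k c d t = (let \<psi> = k * ((max 0 (t - c))\<^sup>2 * (max 0 (d - t))\<^sup>2) in \<psi> / (1 + \<psi>))"

lemma bump_bounds:
  assumes "k \<ge> 0"
  shows "0 \<le> bump k c d t" "bump k c d t \<le> 1"
proof -
  have "0 \<le> k * ((max 0 (t - c))\<^sup>2 * (max 0 (d - t))\<^sup>2)"
    using assms by (intro mult_nonneg_nonneg) auto
  then show "0 \<le> bump k c d t" "bump k c d t \<le> 1"
    by (simp_all add: bump_def Let_def)
qed

lemma C1_on_bump:
  assumes "k \<ge> 0"
  shows "C1_on UNIV (bump k c d)"
proof -
  define \<psi> where "\<psi> t = k * ((max 0 (t - c))\<^sup>2 * (max 0 (d - t))\<^sup>2)" for t :: real
  define \<psi>' where "\<psi>' t = k * (2 * max 0 (t - c) * (max 0 (d - t))\<^sup>2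
    - 2 * max 0 (d - t) * (max 0 (t - c))\<^sup>2)" for t :: real
  have pos: "1 + \<psi> t > 0" for t
    unfolding \<psi>_def using assms by (intro add_pos_nonneg mult_nonneg_nonneg) auto
  have 1: "((\<lambda>t. (max 0 (t - c))\<^sup>2) has_real_derivative 2 * max 0 (t - c)) (at t)" for t
    by (rule DERIV_chain2[OF max_0_power2_has_real_derivative, of "\<lambda>t. t - c" 1, simplified])
       (auto intro!: derivative_eq_intros)
  have 2: "((\<lambda>t. (max 0 (d - t))\<^sup>2) has_real_derivative - (2 * max 0 (d - t))) (at t)" for t
    by (rule DERIV_chain2[OF max_0_power2_has_real_derivative, of "\<lambda>t. d - t" "- 1", simplified])
       (auto intro!: derivative_eq_intros)
  have d\<psi>: "(\<psi> has_real_derivative \<psi>' t) (at t)" for t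
    unfolding \<psi>_def[abs_def] \<psi>'_def
    by (rule derivative_eq_intros 1 2 refl)+ (simp add: algebra_simps)
  have eq: "bump k c d = (\<lambda>t. \<psi> t / (1 + \<psi> t))"
    by (auto simp: bump_def \<psi>_def Let_def fun_eq_iff)
  have "(bump k c d has_real_derivative \<psi>' t / (1 + \<psi> t)\<^sup>2) (at t)" for t
    unfolding eq using pos[of t]
    by (auto intro!: derivative_eq_intros d\<psi> simp: power2_eq_square field_simps)
  moreover have "continuous_on UNIV (\<lambda>t. \<psi>' t / (1 + \<psi> t)\<^sup>2)"
    unfolding \<psi>'_def using pos less_imp_neq[OF pos]
    by (auto intro!: continuous_intros DERIV_continuous_on[OF d\<psi>])
  ultimately show ?thesis
    by (rule C1_on_real)
qed

text \<open>The support lies in the compact interval \<open>{c..d}\<close>, which the strict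
  inequalities place inside the open one. For \<open>d < c\<close> this interval is empty and the
  bump is identically zero, which covers the early members of the sequence used below.\<close>

lemma bump_in_test_functions:
  assumes "k \<ge> 0" "a < c" "d < b"
  shows "bump k c d \<in> test_functions {a<..<b}"
proof -
  have "{t. bump k c d t \<noteq> 0} \<subseteq> {c..d}"
  proof
    fix t assume "t \<in> {t. bump k c d t \<noteq> 0}"
    then have "max 0 (t - c) \<noteq> 0 \<and> max 0 (d - t) \<noteq> 0"
      by (auto simp: bump_def simp del: max_def)
    then show "t \<in> {c..d}"
      by (auto simp: max_def split: if_splits)
  qed
  then have "closure {t. bump k c d t \<noteq> 0} \<subseteq> {c..d}"
    by (simp add: closure_minimal)
  moreover from this have "compact (closure {t. bump k c d t \<noteq> 0})"
    using bounded_closed_interval[of c d] bounded_subset[of "{c..d}"] by (auto simp: compact_eq_bounded_closed)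
  moreover have "{c..d} \<subseteq> {a<..<b}"
    using assms by auto
  ultimately show ?thesis
    using C1_on_bump[OF assms(1)] by (auto simp: test_functions_def)
qed

text \<open>The steepness grows while the end points move inwards by 1 / (n + 1), so that every
  member has its support strictly inside. Outside the interval all members vanish; inside, the
  unscaled profile tends to a positive number, so its n-fold diverges and 1 - 1 / (1 + n
  \<open>\<psi> n\<close>) tends to 1.\<close>

lemma bump_tendsto_indicator:
  "(\<lambda>n. bump (real n) (c + inverse (Suc n)) (d - inverse (Suc n)) t)
     \<longlonglongrightarrow> indicator {c<..<d} t"
proof (cases "t \<in> {c<..<d}")
  case False
  then have "bump (real n) (c + inverse (Suc n)) (d - inverse (Suc n)) t = 0" for n
  proof -
    have "0 < inverse (real (Suc n))" by simp
    then have "t - (c + inverse (Suc n)) \<le> 0 \<or> d - inverse (Suc n) - t \<le> 0"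
      using False unfolding greaterThanLessThan_iff by argo
    then show ?thesis
      by (auto simp: bump_def max_absorb1)
  qed
  then show ?thesis
    using False by simp
next
  case True
  define \<psi> where "\<psi> n = (max 0 (t - (c + inverse (real (Suc n)))))\<^sup>2
    * (max 0 (d - inverse (real (Suc n)) - t))\<^sup>2" for n
  have nn: "\<psi> n \<ge> 0" for n
    by (simp add: \<psi>_def)
  have "\<psi> \<longlonglongrightarrow> (max 0 (t - (c + 0)))\<^sup>2 * (max 0 (d - 0 - t))\<^sup>2"
    unfolding \<psi>_def by (intro tendsto_intros LIMSEQ_inverse_real_of_nat)
  moreover have "(max 0 (t - (c + 0)))\<^sup>2 * (max 0 (d - 0 - t))\<^sup>2 > 0"
    using True by auto
  ultimately have "filterlim (\<lambda>n. \<psi> n * real n) at_top sequentially"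
    using filterlim_real_sequentially filterlim_tendsto_pos_mult_at_top by blast
  then have "filterlim (\<lambda>n. 1 + \<psi> n * real n) at_top sequentially"
    by (rule filterlim_tendsto_add_at_top[OF tendsto_const])
  then have "(\<lambda>n. inverse (1 + \<psi> n * real n)) \<longlonglongrightarrow> 0"
    by (rule tendsto_inverse_0_at_top)
  then have "(\<lambda>n. 1 - inverse (1 + \<psi> n * real n)) \<longlonglongrightarrow> 1 - 0"
    by (intro tendsto_diff tendsto_const)
  moreover have "1 - inverse (1 + \<psi> n * real n)
      = bump (real n) (c + inverse (Suc n)) (d - inverse (Suc n)) t" for n
  proof -
    have "1 + \<psi> n * real n > 0"
      using nn[of n] by (intro add_pos_nonneg) auto
    then have "1 - inverse (1 + \<psi> n * real n) = real n * \<psi> n / (1 + real n * \<psi> n)"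
      by (simp add: field_simps)
    then show ?thesis
      by (simp only: bump_def Let_def \<psi>_def)
  qed
  ultimately show ?thesis
    using True by simp
qed

section \<open>From vanishing test integrals to a null function\<close>

text \<open>The positive and the negative part of \<open>f\<close> are densities of two finite
  measures that agree on all open rays. Rays determine such Borel measures on the line, so the two
  measures coincide.\<close>

lemma AE_zero_if_rays_zero:
  fixes f :: "real \<Rightarrow> real"
  assumes f: "integrable lborel f"
    and zero: "\<And>x. (LINT t|lborel. indicator {x<..} t * f t) = 0"
  shows "AE t in lborel. f t = 0"
proof -
  have [measurable]: "f \<in> borel_measurable lborel"
    using f by simp
  have int: "integrable lborel (\<lambda>t. indicator {x<..} t * max 0 (f t))"
       "integrable lborel (\<lambda>t. indicator {x<..} t * max 0 (- f t))" for x
    by (rule Bochner_Integration.integrable_bound[OF f]; auto simp: indicator_def)+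
  have em: "emeasure (density lborel (\<lambda>t. ennreal (max 0 (g t)))) {x<..}
      = ennreal (LINT t|lborel. indicator {x<..} t * max 0 (g t))"
    if "g = f \<or> g = (\<lambda>t. - f t)" for g x
  proof -
    have [measurable]: "g \<in> borel_measurable lborel"
      using that by auto
    have "emeasure (density lborel (\<lambda>t. ennreal (max 0 (g t)))) {x<..}
        = (\<integral>\<^sup>+ t. ennreal (indicator {x<..} t * max 0 (g t)) \<partial>lborel)"
      by (subst emeasure_density) (auto intro!: nn_integral_cong simp: indicator_def)
    also have "\<dots> = ennreal (LINT t|lborel. indicator {x<..} t * max 0 (g t))"
      using int[of x] that by (intro nn_integral_eq_integral) auto
    finally show ?thesis .
  qed
  have "density lborel (\<lambda>t. ennreal (max 0 (f t))) = density lborel (\<lambda>t. ennreal (max 0 (- f t)))"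
  proof (rule measure_eqI_lessThan)
    fix x :: real
    have "(LINT t|lborel. indicator {x<..} t * max 0 (f t))
        - (LINT t|lborel. indicator {x<..} t * max 0 (- f t))
        = (LINT t|lborel. indicator {x<..} t * f t)"
      by (subst Bochner_Integration.integral_diff[symmetric], rule int, rule int)
         (auto intro!: Bochner_Integration.integral_cong simp: indicator_def)
    then show "emeasure (density lborel (\<lambda>t. ennreal (max 0 (f t)))) {x<..}
        = emeasure (density lborel (\<lambda>t. ennreal (max 0 (- f t)))) {x<..}"
      using em[of f x] em[of "\<lambda>t. - f t" x] zero[of x] by simp
    show "emeasure (density lborel (\<lambda>t. ennreal (max 0 (f t)))) {x<..} < \<infinity>"
      using em[of f x] by simp
  qed auto
  \<comment> \<open>Equal measures have almost everywhere equal densities, and the positive and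
    negative parts of a number agree only if it is 0.\<close>
  then have "AE t in lborel. ennreal (max 0 (f t)) = ennreal (max 0 (- f t))"
    by (intro sigma_finite_measure.density_unique[OF sigma_finite_lborel]) auto
  then show ?thesis
    by eventually_elim (auto simp: max_def split: if_splits)
qed

text \<open>Bumps converge boundedly to indicators of intervals, so dominated convergence passes
  from test functions to rays, where the previous lemma applies to the extension of \<open>g\<close>
  by zero.\<close>

lemma fundamental_lemma_calculus_of_variations:
  fixes g :: "real \<Rightarrow> real"
  assumes g: "integrable (vol {a<..<b}) g"
    and zero: "\<And>\<phi>. \<phi> \<in> test_functions {a<..<b} \<Longrightarrow> (LINT t|vol {a<..<b}. \<phi> t * g t) = 0"
  shows "AE t in vol {a<..<b}. g t = 0"
proof -
  define f where "f t = indicator {a<..<b} t * g t" for t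
  have f: "integrable lborel f"
    using g by (simp add: vol_def integrable_restrict_space f_def[abs_def])
  then have [measurable]: "f \<in> borel_measurable borel"
    by simp
  have test: "(LINT t|lborel. \<phi> t * f t) = 0" if "\<phi> \<in> test_functions {a<..<b}" for \<phi>
    using zero[OF that] by (simp add: vol_def integral_restrict_space f_def mult_ac)
  have "(LINT t|lborel. indicator {x<..} t * f t) = 0" for x
  proof -
    \<comment> \<open>As \<open>f\<close> vanishes outside \<open>{a<..<b}\<close>, the ray from
      \<open>x\<close> acts on it like \<open>{c<..<b}\<close>, which bumps supported inside
      \<open>{a<..<b}\<close> can approximate.\<close>
    define c where "c = max a x"
    let ?\<phi> = "\<lambda>n. bump (real n) (c + inverse (Suc n)) (b - inverse (Suc n))"
    have "(\<lambda>n. LINT t|lborel. ?\<phi> n t * f t) \<longlonglongrightarrow> (LINT t|lborel. indicator {c<..<b} t * f t)"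
    proof (rule integral_dominated_convergence[where w="\<lambda>t. \<bar>f t\<bar>"])
      show "(\<lambda>t. ?\<phi> n t * f t) \<in> borel_measurable lborel" for n
        unfolding bump_def Let_def by measurable
      show "AE t in lborel. (\<lambda>n. ?\<phi> n t * f t) \<longlonglongrightarrow> indicator {c<..<b} t * f t"
        by (intro AE_I2 tendsto_mult bump_tendsto_indicator tendsto_const)
      show "AE t in lborel. norm (?\<phi> n t * f t) \<le> \<bar>f t\<bar>" for n
        using bump_bounds[of "real n"] by (intro AE_I2) (auto simp: abs_mult intro!: mult_left_le_one_le)
    qed (use f in auto)
    moreover have "(LINT t|lborel. ?\<phi> n t * f t) = 0" for n
    proof (rule test[OF bump_in_test_functions])
      have "inverse (real (Suc n)) > 0" by simp
      then show "a < c + inverse (Suc n)" "b - inverse (Suc n) < b"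
        unfolding c_def by linarith+
    qed simp
    ultimately have "(LINT t|lborel. indicator {c<..<b} t * f t) = 0"
      by (simp add: LIMSEQ_const_iff)
    moreover have "indicator {c<..<b} t * f t = indicator {x<..} t * f t" for t
      by (auto simp: c_def f_def indicator_def)
    ultimately show ?thesis by simp
  qed
  then have "AE t in lborel. f t = 0"
    by (intro AE_zero_if_rays_zero f)
  then show ?thesis
    unfolding vol_def by (subst AE_restrict_space_iff) (auto simp: f_def elim!: eventually_mono)
qed

section \<open>Square integrable functions\<close>

lemma square_integrable_scaleR:
  assumes "square_integrable M f"
  shows "square_integrable M (\<lambda>x. c *\<^sub>R f x)"
  using assms by (auto simp: square_integrable_def power_mult_distrib)

lemma integrable_inner_square_integrable:
  assumes f: "square_integrable M f" and g: "square_integrable M g"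
  shows "integrable M (\<lambda>x. f x \<bullet> g x)"
proof (rule Bochner_Integration.integrable_bound)
  show "integrable M (\<lambda>x. (norm (f x))\<^sup>2 + (norm (g x))\<^sup>2)"
    using f g by (simp add: square_integrable_def)
  show "(\<lambda>x. f x \<bullet> g x) \<in> borel_measurable M"
    using f g by (auto simp: square_integrable_def)
  have "norm (f x \<bullet> g x) \<le> norm ((norm (f x))\<^sup>2 + (norm (g x))\<^sup>2)" for x
  proof -
    have "\<bar>f x \<bullet> g x\<bar> \<le> norm (f x) * norm (g x)"
      by (rule Cauchy_Schwarz_ineq2)
    also have "\<dots> \<le> 2 * norm (f x) * norm (g x)"
      by simp
    also have "\<dots> \<le> (norm (f x))\<^sup>2 + (norm (g x))\<^sup>2"
      by (rule sum_squares_bound)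
    finally show ?thesis by simp
  qed
  then show "AE x in M. norm (f x \<bullet> g x) \<le> norm ((norm (f x))\<^sup>2 + (norm (g x))\<^sup>2)"
    by simp
qed

lemma l2_norm_nonneg: "0 \<le> l2_norm M f"
  by (simp add: l2_norm_def)

lemma l2_norm_power2: "(l2_norm M f)\<^sup>2 = (LINT x|M. (norm (f x))\<^sup>2)"
  by (simp add: l2_norm_def)

lemma l2_norm_scaleR: "l2_norm M (\<lambda>x. c *\<^sub>R f x) = \<bar>c\<bar> * l2_norm M f"
  by (simp add: l2_norm_def power_mult_distrib real_sqrt_mult)

lemma l2_norm_cong_AE:
  assumes "AE x in M. f x = g x" "f \<in> borel_measurable M" "g \<in> borel_measurable M"
  shows "l2_norm M f = l2_norm M g"
  unfolding l2_norm_def using assms by (intro arg_cong[of _ _ sqrt] integral_cong_AE) auto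

lemma l2_norm_eq_0_iff:
  assumes "square_integrable M f"
  shows "l2_norm M f = 0 \<longleftrightarrow> (AE x in M. f x = 0)"
  using assms unfolding l2_norm_def square_integrable_def
  by (simp add: integral_nonneg_eq_0_iff_AE)

lemma abs_integral_inner_le_l2_norm:
  assumes f: "square_integrable M f" and g: "square_integrable M g"
  shows "\<bar>LINT x|M. f x \<bullet> g x\<bar> \<le> l2_norm M f * l2_norm M g"
proof (cases "l2_norm M g = 0")
  case True
  then have "AE x in M. g x = 0"
    using g l2_norm_eq_0_iff by blast
  then have "(LINT x|M. f x \<bullet> g x) = 0"
    by (intro integral_eq_zero_AE) (auto elim: eventually_mono)
  with True show ?thesis by simp
next
  case False
  define A B I where "A = (LINT x|M. (norm (f x))\<^sup>2)" and "B = (LINT x|M. (norm (g x))\<^sup>2)"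
    and "I = (LINT x|M. f x \<bullet> g x)"
  have "B > 0"
    using False l2_norm_power2[of M g] unfolding B_def by (metis zero_less_power2)
  have int: "integrable M (\<lambda>x. (norm (f x))\<^sup>2)" "integrable M (\<lambda>x. (norm (g x))\<^sup>2)"
    using f g by (auto simp: square_integrable_def)
  note fg = integrable_inner_square_integrable[OF f g]
  \<comment> \<open>The integrand is, up to the factor \<open>B\<close>, \<open>f\<close> minus its
    L^2 projection onto \<open>g\<close>; multiplying by \<open>B\<close> avoids a quotient.
    Expanding the square gives Cauchy-Schwarz.\<close>
  have "0 \<le> (LINT x|M. (norm (B *\<^sub>R f x - I *\<^sub>R g x))\<^sup>2)"
    by simp
  also have "\<dots> = (LINT x|M. B\<^sup>2 * (norm (f x))\<^sup>2 - 2 * B * I * (f x \<bullet> g x) + I\<^sup>2 * (norm (g x))\<^sup>2)"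
    by (intro Bochner_Integration.integral_cong refl)
       (simp add: power2_norm_eq_inner inner_diff_left inner_diff_right inner_commute,
        simp add: algebra_simps power2_eq_square)
  also have "\<dots> = B\<^sup>2 * A - 2 * B * I * I + I\<^sup>2 * B"
    using int fg by (simp add: A_def B_def I_def)
  also have "\<dots> = B * (A * B - I\<^sup>2)"
    by (simp add: power2_eq_square algebra_simps)
  finally have "I\<^sup>2 \<le> A * B"
    using \<open>B > 0\<close> by (simp add: zero_le_mult_iff)
  then have "\<bar>I\<bar>\<^sup>2 \<le> (l2_norm M f * l2_norm M g)\<^sup>2"
    by (simp add: power_mult_distrib l2_norm_power2 A_def B_def)
  then show ?thesis
    unfolding I_def by (rule power2_le_imp_le) (simp add: l2_norm_nonneg)
qed

section \<open>Uniqueness of tangential gradients\<close>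

lemma bounded_bilinear_matrix_vector_mult:
  "bounded_bilinear ((*v) :: real^'n^'m \<Rightarrow> real^'n \<Rightarrow> real^'m)"
  unfolding bilinear_conv_bounded_bilinear[symmetric] bilinear_def
  by (auto intro!: linearI simp: matrix_vector_mult_add_rdistrib matrix_vector_right_distrib
      scaleR_matrix_vector_assoc[symmetric] matrix_vector_mult_scaleR)

lemma test_function_continuous:
  assumes "\<phi> \<in> test_functions S"
  shows "continuous_on UNIV \<phi>"
  using assms by (auto simp: test_functions_def C1_on_def continuous_on_eq_continuous_at
      intro: differentiable_imp_continuous_within)

lemma test_function_bounded:
  assumes "\<phi> \<in> test_functions S"
  obtains C where "\<And>x. \<bar>\<phi> x\<bar> \<le> C"
proof -
  let ?K = "closure {x. \<phi> x \<noteq> 0}"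
  have "compact (\<phi> ` ?K)"
    using assms by (intro compact_continuous_image continuous_on_subset[OF test_function_continuous])
      (auto simp: test_functions_def)
  then obtain C where C: "\<And>x. x \<in> ?K \<Longrightarrow> \<bar>\<phi> x\<bar> \<le> C"
    using compact_imp_bounded bounded_iff by (metis imageI real_norm_def)
  \<comment> \<open>\<open>C\<close> is only a bound on the support, which may be empty, so
    \<open>C\<close> may be negative; the maximum also covers the points where \<open>\<phi>\<close>
    vanishes.\<close>
  have "\<bar>\<phi> x\<bar> \<le> max C 0" for x
    using C[of x] closure_subset[of "{x. \<phi> x \<noteq> 0}"] by (cases "\<phi> x = 0") auto
  with that show ?thesis by blast
qed

text \<open>What tangential gradients demand of the curve: continuity makes the velocity measurable,
  and the bound makes the length finite. The velocity may vanish here; \<open>arclength\<close>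
  gives such points no weight.\<close>

locale bounded_speed_curve =
  fixes \<gamma> :: "real \<Rightarrow> vec3" and B :: real
  assumes continuous_velocity: "continuous_on {0<..<1} (velocity \<gamma>)"
    and velocity_bound: "\<And>t. t \<in> {0<..<1} \<Longrightarrow> norm (velocity \<gamma> t) \<le> B"
begin

lemma measurable_velocity [measurable]: "velocity \<gamma> \<in> borel_measurable (vol {0<..<1})"
  using borel_measurable_continuous_on_restrict[OF continuous_velocity]
  by (simp add: vol_def cong: measurable_cong_sets sets_restrict_space_cong)

lemma borel_measurable_arclength: "borel_measurable (arclength \<gamma>) = borel_measurable (vol {0<..<1})"
  by (simp add: arclength_def cong: measurable_cong_sets)

lemma integrable_speed: "integrable (vol {0<..<1}) (\<lambda>t. norm (velocity \<gamma> t))"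
proof (rule Bochner_Integration.integrable_bound)
  show "integrable (vol {0<..<1::real}) (\<lambda>t. B)"
    by (simp add: vol_def integrable_restrict_space)
  show "AE t in vol {0<..<1}. norm (norm (velocity \<gamma> t)) \<le> norm B"
    using velocity_bound by (intro AE_I2) (force simp: vol_def space_restrict_space)
qed measurable

text \<open>The hypothesis is weighted by the speed, the conclusion is not. From x \<le> 1 + x^2 the
  integrand is at most a constant times speed plus speed times the square of the norm of
  \<open>G\<close>: the first term is controlled by the finite length, the second by the
  hypothesis.\<close>

lemma integrable_tangential_derivative:
  fixes G :: "vec3 \<Rightarrow> real^3^3"
  assumes G: "square_integrable (arclength \<gamma>) (\<lambda>t. G (\<gamma> t))"
  shows "integrable (vol {0<..<1}) (\<lambda>t. G (\<gamma> t) *v velocity \<gamma> t)"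
proof -
  obtain K where K: "\<And>(A :: real^3^3) x. norm (A *v x) \<le> norm A * norm x * K" and "K \<ge> 0"
    using bounded_bilinear.nonneg_bounded[OF bounded_bilinear_matrix_vector_mult] by metis
  have G_meas [measurable]: "(\<lambda>t. G (\<gamma> t)) \<in> borel_measurable (vol {0<..<1})"
    using G by (simp add: square_integrable_def borel_measurable_arclength)
  show ?thesis
  proof (rule Bochner_Integration.integrable_bound)
    have "integrable (vol {0<..<1}) (\<lambda>t. norm (velocity \<gamma> t) *\<^sub>R (norm (G (\<gamma> t)))\<^sup>2)"
      using G by (subst integrable_density[symmetric]) (auto simp: square_integrable_def arclength_def)
    then show "integrable (vol {0<..<1})
        (\<lambda>t. K * (norm (velocity \<gamma> t) + norm (velocity \<gamma> t) *\<^sub>R (norm (G (\<gamma> t)))\<^sup>2))"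
      using integrable_speed by (intro Bochner_Integration.integrable_mult_right
        Bochner_Integration.integrable_add)
    show "(\<lambda>t. G (\<gamma> t) *v velocity \<gamma> t) \<in> borel_measurable (vol {0<..<1})"
      by (rule borel_measurable_continuous_Pair)
         (auto intro!: bounded_bilinear.continuous_on[OF bounded_bilinear_matrix_vector_mult]
           continuous_intros)
    have "norm (G (\<gamma> t) *v velocity \<gamma> t)
        \<le> K * (norm (velocity \<gamma> t) + norm (velocity \<gamma> t) *\<^sub>R (norm (G (\<gamma> t)))\<^sup>2)" for t
    proof -
      have "norm (G (\<gamma> t)) \<le> 1 + (norm (G (\<gamma> t)))\<^sup>2"
        using sum_squares_bound[of 1 "norm (G (\<gamma> t))"] norm_ge_zero[of "G (\<gamma> t)"]
        unfolding power_one by linarith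
      then have "norm (G (\<gamma> t)) * norm (velocity \<gamma> t) * K
          \<le> (1 + (norm (G (\<gamma> t)))\<^sup>2) * norm (velocity \<gamma> t) * K"
        using \<open>K \<ge> 0\<close> by (intro mult_right_mono) auto
      with K[of "G (\<gamma> t)" "velocity \<gamma> t"] show ?thesis
        by (simp add: algebra_simps)
    qed
    then show "AE t in vol {0<..<1}. norm (G (\<gamma> t) *v velocity \<gamma> t)
        \<le> norm (K * (norm (velocity \<gamma> t) + norm (velocity \<gamma> t) *\<^sub>R (norm (G (\<gamma> t)))\<^sup>2))"
      by (intro AE_I2) (metis abs_ge_self order_trans real_norm_def)
  qed
qed

lemma integrable_test_function_scaleR:
  fixes g :: "real \<Rightarrow> 'b::euclidean_space"
  assumes \<phi>: "\<phi> \<in> test_functions S" and g: "integrable (vol {0<..<1}) g"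
  shows "integrable (vol {0<..<1}) (\<lambda>t. \<phi> t *\<^sub>R g t)"
proof -
  obtain C where C: "\<And>x. \<bar>\<phi> x\<bar> \<le> C"
    using test_function_bounded[OF \<phi>] by blast
  have [measurable]: "\<phi> \<in> borel_measurable (vol {0<..<1})"
    using borel_measurable_continuous_onI[OF test_function_continuous[OF \<phi>]]
    by (simp add: vol_def measurable_restrict_space1)
  have [measurable]: "g \<in> borel_measurable (vol {0<..<1})"
    using g by simp
  show ?thesis
  proof (rule Bochner_Integration.integrable_bound)
    show "integrable (vol {0<..<1}) (\<lambda>t. C *\<^sub>R g t)"
      using g by simp
    show "AE t in vol {0<..<1}. norm (\<phi> t *\<^sub>R g t) \<le> norm (C *\<^sub>R g t)"
      using order_trans[OF C abs_ge_self] by (intro AE_I2) (simp add: mult_right_mono)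
  qed measurable
qed

text \<open>The weak chain rule determines the action on the velocity up to null sets, by the
  fundamental lemma in each component; the action on normal vectors is zero by definition. Together
  these fix the matrix wherever the velocity is nonzero.\<close>

lemma tangential_gradient_unique:
  assumes G1: "is_tangential_gradient \<gamma> w G1" and G2: "is_tangential_gradient \<gamma> w G2"
  shows "AE t in arclength \<gamma>. G1 (\<gamma> t) = G2 (\<gamma> t)"
proof -
  define D where "D t = G1 (\<gamma> t) - G2 (\<gamma> t)" for t
  define g where "g t = D t *v velocity \<gamma> t" for t
  have int: "integrable (vol {0<..<1}) (\<lambda>t. G1 (\<gamma> t) *v velocity \<gamma> t)"
      "integrable (vol {0<..<1}) (\<lambda>t. G2 (\<gamma> t) *v velocity \<gamma> t)"
    using G1 G2 by (auto intro: integrable_tangential_derivative simp: is_tangential_gradient_def)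
  have g_eq: "g t = G1 (\<gamma> t) *v velocity \<gamma> t - G2 (\<gamma> t) *v velocity \<gamma> t" for t
    by (simp add: g_def D_def matrix_vector_mult_diff_rdistrib)
  have g: "integrable (vol {0<..<1}) g"
    unfolding g_eq using int by simp
  have "AE t in vol {0<..<1}. g t $ i = 0" for i
  proof (rule fundamental_lemma_calculus_of_variations)
    show "integrable (vol {0<..<1}) (\<lambda>t. g t $ i)"
      using integrable_bounded_linear[OF bounded_linear_vec_nth g] .
    fix \<phi> :: "real \<Rightarrow> real" assume \<phi>: "\<phi> \<in> test_functions {0<..<1}"
    have "(LINT t|vol {0<..<1}. \<phi> t *\<^sub>R g t)
        = (LINT t|vol {0<..<1}. \<phi> t *\<^sub>R (G1 (\<gamma> t) *v velocity \<gamma> t))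
          - (LINT t|vol {0<..<1}. \<phi> t *\<^sub>R (G2 (\<gamma> t) *v velocity \<gamma> t))"
      unfolding g_eq scaleR_diff_right
      by (intro Bochner_Integration.integral_diff integrable_test_function_scaleR[OF \<phi>] int)
    also have "\<dots> = 0"
      using G1 G2 \<phi> by (auto simp: is_tangential_gradient_def)
    finally show "(LINT t|vol {0<..<1}. \<phi> t * g t $ i) = 0"
      using integral_bounded_linear[OF bounded_linear_vec_nth[of i]
          integrable_test_function_scaleR[OF \<phi> g]] by simp
  qed
  then have "AE t in vol {0<..<1}. \<forall>i. g t $ i = 0"
    by (simp add: AE_all_countable)
  \<comment> \<open>\<open>arclength\<close> has the speed as density, so equality is only required
    where the speed is positive; this is the form that \<open>AE_density\<close> turns into the
    claim.\<close>
  then have "AE t in vol {0<..<1}. 0 < ennreal (norm (velocity \<gamma> t)) \<longrightarrow> G1 (\<gamma> t) = G2 (\<gamma> t)"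
  proof (rule AE_mp, intro AE_I2 impI)
    fix t :: real
    let ?v = "velocity \<gamma> t"
    assume t: "t \<in> space (vol {0<..<1})" and "\<forall>i. g t $ i = 0" and "0 < ennreal (norm ?v)"
    then have gt: "D t *v ?v = 0" and v: "?v \<noteq> 0"
      by (auto simp: vec_eq_iff g_def)
    have normal: "D t *v n = 0" if "n \<bullet> ?v = 0" for n
      using G1 G2 t that by (auto simp: D_def is_tangential_gradient_def vol_def space_restrict_space
          matrix_vector_mult_diff_rdistrib)
    have "D t *v x = 0 *v x" for x
    proof -
      \<comment> \<open>\<open>c\<close> is the coefficient of the orthogonal projection of
        \<open>x\<close> onto the tangent line, so \<open>x\<close> minus that projection is
        normal.\<close>
      define c where "c = (x \<bullet> ?v) / (?v \<bullet> ?v)"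
      have "D t *v (x - c *\<^sub>R ?v) = 0"
        using v by (intro normal) (simp add: c_def inner_diff_left)
      then show ?thesis
        using gt by (simp add: matrix_vector_mult_diff_distrib matrix_vector_mult_scaleR)
    qed
    then show "G1 (\<gamma> t) = G2 (\<gamma> t)"
      using matrix_eq[of "D t" 0] by (simp add: D_def)
  qed
  then show ?thesis
    unfolding arclength_def by (subst AE_density) auto
qed

text \<open>Uniqueness makes the norm independent of the gradient picked by \<open>SOME\<close>, so
  any convenient one may be used to compute it.\<close>

lemma tangential_gradient_norm_eq:
  assumes "is_tangential_gradient \<gamma> w G"
  shows "tangential_gradient_norm \<gamma> w = l2_norm (arclength \<gamma>) (\<lambda>t. G (\<gamma> t))"
proof -
  have *: "is_tangential_gradient \<gamma> w (tangential_gradient \<gamma> w)"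
    unfolding tangential_gradient_def by (rule someI[of "is_tangential_gradient \<gamma> w", OF assms])
  show ?thesis
    unfolding tangential_gradient_norm_def
    using tangential_gradient_unique[OF * assms] assms *
    by (intro l2_norm_cong_AE) (auto simp: is_tangential_gradient_def square_integrable_def)
qed

lemma is_tangential_gradient_scaleR:
  assumes "is_tangential_gradient \<gamma> w G"
  shows "is_tangential_gradient \<gamma> (\<lambda>x. c *\<^sub>R w x) (\<lambda>x. c *\<^sub>R G x)"
  using assms square_integrable_scaleR[of "arclength \<gamma>" "\<lambda>t. G (\<gamma> t)" c]
  by (auto simp: is_tangential_gradient_def scaleR_matrix_vector_assoc[symmetric]
      scaleR_left_commute[where b=c] simp del: scaleR_scaleR)

lemma W_norm_scaleR:
  assumes "w \<in> W \<gamma>"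
  shows "W_norm \<gamma> (\<lambda>x. c *\<^sub>R w x) = \<bar>c\<bar> * W_norm \<gamma> w"
proof -
  obtain G where "is_tangential_gradient \<gamma> w G"
    using assms by (auto simp: W_def)
  then show ?thesis
    by (simp add: W_norm_def tangential_gradient_norm_eq is_tangential_gradient_scaleR
        tangential_gradient_norm_eq[OF is_tangential_gradient_scaleR] l2_norm_scaleR distrib_left)
qed

end

section \<open>Velocity of the center line of the fiber\<close>

text \<open>By the chain rule the velocity is the derivative of \<open>\<Phi>\<close> in direction
  \<open>q - p\<close> along the segment. It extends continuously to the closed parameter interval,
  where compactness bounds it.\<close>

lemma fiber_geometry_bounded_speed:
  assumes "fiber_geometry \<Omega> a p q \<Phi> \<gamma>"
  obtains B where "bounded_speed_curve \<gamma> B"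
proof -
  let ?l = "linepath p q"
  define D where "D t = frechet_derivative \<Phi> (at (?l t)) (q - p)" for t
  obtain U where U: "closure (tube ?l a) \<subseteq> U" and "C1_on U \<Phi>" and \<gamma>: "\<gamma> = \<Phi> \<circ> ?l" and "a > 0"
    using assms by (auto simp: fiber_geometry_def diffeomorphism_on_def)
  \<comment> \<open>As \<open>a > 0\<close>, each axis point lies in its own disk. The curve omits
    its end points; taking closures brings them into \<open>U\<close>.\<close>
  have "?l ` {0<..<1} \<subseteq> tube ?l a"
    using \<open>a > 0\<close> by (force simp: tube_def curve_def normal_disk_def)
  then have "closure (?l ` {0<..<1}) \<subseteq> U"
    using U closure_mono by blast
  moreover have "?l ` closure {0<..<1} \<subseteq> closure (?l ` {0<..<1})"
    by (intro image_closure_subset continuous_intros) (auto simp: closure_subset)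
  ultimately have sub: "?l ` {0..1} \<subseteq> U"
    by (simp add: closure_greaterThanLessThan)
  have diff: "(\<Phi> has_derivative frechet_derivative \<Phi> (at x)) (at x)" if "x \<in> U" for x
    using \<open>C1_on U \<Phi>\<close> that by (auto simp: C1_on_def frechet_derivative_works)
  have vel: "velocity \<gamma> t = D t" if "t \<in> {0<..<1}" for t
  proof -
    have l: "(?l has_derivative (\<lambda>x. x *\<^sub>R (q - p))) (at t)"
      using has_vector_derivative_linepath_within[of p q t UNIV]
      by (simp add: has_vector_derivative_def)
    have "?l t \<in> U"
      using that sub by auto
    have "(\<gamma> has_derivative (\<lambda>x. frechet_derivative \<Phi> (at (?l t)) (x *\<^sub>R (q - p)))) (at t)"
      unfolding \<gamma> o_def by (rule has_derivative_compose[OF l diff[OF \<open>?l t \<in> U\<close>]])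
    then have "(\<gamma> has_vector_derivative D t) (at t)"
      using linear_cmul[OF has_derivative_linear[OF diff[OF \<open>?l t \<in> U\<close>]]]
      by (simp add: has_vector_derivative_def D_def)
    then show ?thesis
      unfolding velocity_def by (rule vector_derivative_at)
  qed
  \<comment> \<open>\<open>C1_on\<close> asserts continuity of the derivative only in basis
    directions, so \<open>q - p\<close> is expanded in the basis.\<close>
  have "D t = (\<Sum>b\<in>Basis. ((q - p) \<bullet> b) *\<^sub>R frechet_derivative \<Phi> (at (?l t)) b)" if "t \<in> {0..1}" for t
  proof -
    have lin: "linear (frechet_derivative \<Phi> (at (?l t)))"
      using sub that by (intro has_derivative_linear[OF diff]) auto
    have "D t = frechet_derivative \<Phi> (at (?l t)) (\<Sum>b\<in>Basis. ((q - p) \<bullet> b) *\<^sub>R b)"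
      unfolding D_def by (simp only: euclidean_representation)
    then show ?thesis
      by (simp only: linear_sum[OF lin] linear_cmul[OF lin])
  qed
  moreover have "continuous_on {0..1} (\<lambda>t. \<Sum>b\<in>Basis. ((q - p) \<bullet> b) *\<^sub>R frechet_derivative \<Phi> (at (?l t)) b)"
    using \<open>C1_on U \<Phi>\<close> sub unfolding C1_on_def
    by (intro continuous_on_sum continuous_on_scaleR continuous_on_const
        continuous_on_compose2[OF _ continuous_on_linepath]) auto
  ultimately have cont: "continuous_on {0..1} D"
    using continuous_on_cong[OF refl] by (metis (no_types, lifting))
  then have "bounded (D ` {0..1})"
    by (intro compact_imp_bounded compact_continuous_image) auto
  then obtain B where B: "\<And>t. t \<in> {0..1} \<Longrightarrow> norm (D t) \<le> B"
    unfolding bounded_iff by blast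
  have "bounded_speed_curve \<gamma> B"
  proof
    show "continuous_on {0<..<1} (velocity \<gamma>)"
      using continuous_on_subset[OF cont greaterThanLessThan_subseteq_atLeastAtMost_iff[THEN iffD2]] vel
      by (subst continuous_on_cong[OF refl vel]) auto
    show "norm (velocity \<gamma> t) \<le> B" if "t \<in> {0<..<1}" for t
      using vel[OF that] B[of t] that by simp
  qed
  with that show ?thesis .
qed

section \<open>The inf-sup condition\<close>

lemma averaging_zero: "averaging \<gamma> a (\<lambda>_. 0) x = 0"
  by (simp add: averaging_def)

lemma abs_inner_curve_le:
  assumes "q \<in> W \<gamma>" "w \<in> W \<gamma>"
  shows "\<bar>inner_curve \<gamma> q w\<bar> \<le> l2_norm (arclength \<gamma>) (\<lambda>t. q (\<gamma> t)) * l2_norm (arclength \<gamma>) (\<lambda>t. w (\<gamma> t))"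
  using assms abs_integral_inner_le_l2_norm[of "arclength \<gamma>" "\<lambda>t. q (\<gamma> t)" "\<lambda>t. w (\<gamma> t)"]
  by (simp add: inner_curve_def W_def)

lemma inner_curve_self: "inner_curve \<gamma> w w = (l2_norm (arclength \<gamma>) (\<lambda>t. w (\<gamma> t)))\<^sup>2"
  by (simp add: inner_curve_def l2_norm_power2 power2_norm_eq_inner)

lemma inner_curve_commute: "inner_curve \<gamma> q w = inner_curve \<gamma> w q"
  by (simp add: inner_curve_def inner_commute)

lemma inner_curve_scaleR: "inner_curve \<gamma> q (\<lambda>x. c *\<^sub>R w x) = c * inner_curve \<gamma> q w"
  by (simp add: inner_curve_def)

lemma zero_on_curve_iff_l2_norm:
  assumes "w \<in> W \<gamma>"
  shows "zero_on_curve \<gamma> w \<longleftrightarrow> l2_norm (arclength \<gamma>) (\<lambda>t. w (\<gamma> t)) = 0"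
  using assms l2_norm_eq_0_iff by (fastforce simp: W_def zero_on_curve_def)

lemma zero_on_curve_imp_inner_curve_0:
  assumes "zero_on_curve \<gamma> w"
  shows "inner_curve \<gamma> q w = 0"
  unfolding inner_curve_def using assms
  by (intro integral_eq_zero_AE) (auto simp: zero_on_curve_def elim: eventually_mono)

lemma tangential_gradient_norm_nonneg: "0 \<le> tangential_gradient_norm \<gamma> w"
  by (simp add: tangential_gradient_norm_def l2_norm_nonneg)

lemma l2_norm_le_W_norm: "l2_norm (arclength \<gamma>) (\<lambda>t. w (\<gamma> t)) \<le> W_norm \<gamma> w"
  by (simp add: W_norm_def tangential_gradient_norm_nonneg)

lemma W_norm_pos:
  assumes "w \<in> W \<gamma>" "\<not> zero_on_curve \<gamma> w"
  shows "0 < W_norm \<gamma> w"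
  using assms l2_norm_le_W_norm[of \<gamma> w] l2_norm_nonneg[of "arclength \<gamma>" "\<lambda>t. w (\<gamma> t)"]
  by (simp add: zero_on_curve_iff_l2_norm)

lemma H1_norm_nonneg: "0 \<le> H1_norm \<Omega> v"
  by (simp add: H1_norm_def l2_norm_nonneg)

section \<open>The dual norm of elements of \<open>W \<gamma>\<close>\<close>

text \<open>Cauchy-Schwarz bounds every quotient by the L^2 norm of \<open>q\<close>. The real
  supremum in \<open>dual_norm\<close> is meaningful only with such a bound.\<close>

lemma Q_norm_upper_bdd:
  assumes q: "q \<in> W \<gamma>"
  shows "bdd_above ((\<lambda>w. \<bar>inner_curve \<gamma> q w\<bar> / W_norm \<gamma> w) ` {w \<in> W \<gamma>. \<not> zero_on_curve \<gamma> w})"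
proof (rule bdd_aboveI2)
  fix w assume w: "w \<in> {w \<in> W \<gamma>. \<not> zero_on_curve \<gamma> w}"
  have "\<bar>inner_curve \<gamma> q w\<bar> \<le> l2_norm (arclength \<gamma>) (\<lambda>t. q (\<gamma> t)) * W_norm \<gamma> w"
    using abs_inner_curve_le[OF q, of w] w
    by (auto intro: order_trans mult_left_mono l2_norm_le_W_norm l2_norm_nonneg)
  then show "\<bar>inner_curve \<gamma> q w\<bar> / W_norm \<gamma> w \<le> l2_norm (arclength \<gamma>) (\<lambda>t. q (\<gamma> t))"
    using W_norm_pos[of w] w by (simp add: divide_simps)
qed

text \<open>Testing with \<open>q\<close> itself produces its squared L^2 norm.\<close>

lemma Q_norm_pos:
  assumes q: "q \<in> W \<gamma>" "\<not> zero_on_curve \<gamma> q"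
  shows "0 < Q_norm \<gamma> q"
proof -
  have "0 < inner_curve \<gamma> q q"
    using q by (simp add: inner_curve_self zero_on_curve_iff_l2_norm)
  then have "0 < \<bar>inner_curve \<gamma> q q\<bar> / W_norm \<gamma> q"
    using W_norm_pos[OF q] by simp
  also have "\<dots> \<le> Q_norm \<gamma> q"
    unfolding Q_norm_def dual_norm_def using q
    by (intro cSUP_upper Q_norm_upper_bdd) auto
  finally show ?thesis .
qed

text \<open>The supremum may fail to be a maximum, but half of it lies strictly below it because it
  is positive, so some quotient exceeds that half.\<close>

lemma Q_norm_almost_attained:
  assumes q: "q \<in> W \<gamma>" "\<not> zero_on_curve \<gamma> q"
  obtains w where "w \<in> W \<gamma>" "\<not> zero_on_curve \<gamma> w"
    "Q_norm \<gamma> q / 2 * W_norm \<gamma> w < \<bar>inner_curve \<gamma> q w\<bar>"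
proof -
  have "Q_norm \<gamma> q / 2 < (SUP w\<in>{w \<in> W \<gamma>. \<not> zero_on_curve \<gamma> w}. \<bar>inner_curve \<gamma> q w\<bar> / W_norm \<gamma> w)"
    using Q_norm_pos[OF q] by (simp add: Q_norm_def dual_norm_def)
  then obtain w where w: "w \<in> W \<gamma>" "\<not> zero_on_curve \<gamma> w"
      "Q_norm \<gamma> q / 2 < \<bar>inner_curve \<gamma> q w\<bar> / W_norm \<gamma> w"
    using q Q_norm_upper_bdd[OF q(1)] by (subst (asm) less_cSUP_iff) auto
  with W_norm_pos[of w] that[of w] show ?thesis
    by (simp add: field_simps)
qed

section \<open>Stability of the L2 projection and the resulting test function\<close>

lemma is_L2_projection_inner_curve:
  assumes "is_L2_projection \<gamma> S P" "S \<subseteq> W \<gamma>" "w \<in> W \<gamma>" "q \<in> S"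
  shows "inner_curve \<gamma> q (P w) = inner_curve \<gamma> q w"
proof -
  have "P w \<in> W \<gamma>" and 0: "inner_curve \<gamma> (\<lambda>x. w x - P w x) q = 0"
    using assms by (auto simp: is_L2_projection_def)
  moreover have "q \<in> W \<gamma>"
    using assms by blast
  ultimately have "inner_curve \<gamma> (\<lambda>x. w x - P w x) q = inner_curve \<gamma> w q - inner_curve \<gamma> (P w) q"
    using assms(3) unfolding inner_curve_def inner_diff_left
    by (intro Bochner_Integration.integral_diff integrable_inner_square_integrable) (auto simp: W_def)
  with 0 show ?thesis
    by (simp add: inner_curve_commute[of \<gamma> q])
qed

text \<open>Pairing with \<open>P w\<close> gives |Pw|^2 = (Pw, w) \<le> |Pw| |w| in L^2, and a
  nonzero factor |Pw| cancels.\<close>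

lemma is_L2_projection_l2_norm_le:
  assumes P: "is_L2_projection \<gamma> S P" "S \<subseteq> W \<gamma>" and w: "w \<in> W \<gamma>"
  shows "l2_norm (arclength \<gamma>) (\<lambda>t. P w (\<gamma> t)) \<le> l2_norm (arclength \<gamma>) (\<lambda>t. w (\<gamma> t))"
proof -
  let ?n = "\<lambda>w. l2_norm (arclength \<gamma>) (\<lambda>t. w (\<gamma> t))"
  have Pw: "P w \<in> S" "P w \<in> W \<gamma>"
    using assms by (auto simp: is_L2_projection_def)
  have "?n (P w) * ?n (P w) = inner_curve \<gamma> (P w) w"
    using is_L2_projection_inner_curve[OF P w Pw(1)] by (simp add: inner_curve_self power2_eq_square)
  also have "\<dots> \<le> ?n (P w) * ?n w"
    using abs_inner_curve_le[OF Pw(2) w] by linarith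
  finally show ?thesis
    using l2_norm_nonneg[of "arclength \<gamma>" "\<lambda>t. P w (\<gamma> t)"] l2_norm_nonneg[of "arclength \<gamma>" "\<lambda>t. w (\<gamma> t)"]
    by (cases "?n (P w) = 0") (auto simp: mult_le_cancel_left)
qed

text \<open>The L^2 part is stable with constant 1 and the gradient part with constant
  \<open>c\<close>; the maximum serves both.\<close>

lemma is_L2_projection_W_norm_le:
  assumes P: "is_L2_projection \<gamma> S P" "S \<subseteq> W \<gamma>" and w: "w \<in> W \<gamma>"
    and stable: "tangential_gradient_norm \<gamma> (P w) \<le> c * tangential_gradient_norm \<gamma> w"
  shows "W_norm \<gamma> (P w) \<le> max 1 c * W_norm \<gamma> w"
proof -
  have "l2_norm (arclength \<gamma>) (\<lambda>t. w (\<gamma> t)) \<le> max 1 c * l2_norm (arclength \<gamma>) (\<lambda>t. w (\<gamma> t))"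
    using mult_right_mono[of 1 "max 1 c" "l2_norm (arclength \<gamma>) (\<lambda>t. w (\<gamma> t))"]
    by (simp add: l2_norm_nonneg)
  moreover have "c * tangential_gradient_norm \<gamma> w \<le> max 1 c * tangential_gradient_norm \<gamma> w"
    by (intro mult_right_mono tangential_gradient_norm_nonneg) simp
  ultimately show ?thesis
    using is_L2_projection_l2_norm_le[OF P w] stable unfolding W_norm_def distrib_left by linarith
qed

text \<open>In the application \<open>N\<close> is the norm of the zero function, which is computed from a chosen
  weak gradient. Scaling the witness makes \<open>N\<close> harmless without uniqueness of weak gradients.\<close>

lemma (in bounded_speed_curve) discrete_inf_sup_witness:
  assumes P: "is_L2_projection \<gamma> S P" "S \<subseteq> W \<gamma>" and S: "function_subspace S"
    and stable: "\<And>w. w \<in> W \<gamma> \<Longrightarrow> tangential_gradient_norm \<gamma> (P w) \<le> c * tangential_gradient_norm \<gamma> w"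
    and q: "q \<in> S" "\<not> zero_on_curve \<gamma> q" and N: "N \<ge> 0"
  obtains w where "w \<in> S" "\<not> zero_on_curve \<gamma> w"
    "1 / (4 * max 1 c) \<le> inner_curve \<gamma> q (\<lambda>x. - w x) / ((N + W_norm \<gamma> w) * Q_norm \<gamma> q)"
proof -
  define C where "C = max 1 c"
  have "C > 0"
    by (simp add: C_def)
  have qW: "q \<in> W \<gamma>"
    using P q by blast
  then obtain w where w: "w \<in> W \<gamma>" "\<not> zero_on_curve \<gamma> w"
      and almost: "Q_norm \<gamma> q / 2 * W_norm \<gamma> w < \<bar>inner_curve \<gamma> q w\<bar>"
    using q Q_norm_almost_attained by blast
  have Pw: "P w \<in> S" "P w \<in> W \<gamma>"
    using P w by (auto simp: is_L2_projection_def)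
  have W: "0 < W_norm \<gamma> w" and Q: "0 < Q_norm \<gamma> q"
    using W_norm_pos w Q_norm_pos qW q by auto
  define I where "I = inner_curve \<gamma> q w"
  \<comment> \<open>With this \<open>k\<close>, \<open>N\<close> is at most
    \<open>k * (C * W_norm \<gamma> w)\<close>, so adding it at most doubles the bound for the
    scaled witness. The summand 1 keeps \<open>k\<close> positive for \<open>N = 0\<close>.\<close>
  define k where "k = 1 + N / (C * W_norm \<gamma> w)"
  have k: "k > 0" "N \<le> k * (C * W_norm \<gamma> w)"
    using N W \<open>C > 0\<close> by (simp_all add: k_def add_pos_nonneg distrib_right)
  \<comment> \<open>The sign makes the pairing of \<open>q\<close> with the negated witness equal to
    \<open>k * \<bar>I\<bar>\<close>, hence positive.\<close>
  define s where "s = - sgn I * k"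
  define w' where "w' x = s *\<^sub>R P w x" for x
  have "0 < Q_norm \<gamma> q / 2 * W_norm \<gamma> w"
    using W Q by simp
  with almost have I: "I \<noteq> 0"
    by (auto simp: I_def)
  then have s: "\<bar>s\<bar> = k" "s * I = - (k * \<bar>I\<bar>)"
    using k by (auto simp: s_def abs_mult sgn_if)
  have inner: "inner_curve \<gamma> q w' = s * I"
    using is_L2_projection_inner_curve[OF P w(1) q(1)] by (simp add: w'_def[abs_def] inner_curve_scaleR I_def)
  show thesis
  proof (rule that[of w'])
    show "w' \<in> S"
      using S Pw unfolding w'_def[abs_def] function_subspace_def by blast
    \<comment> \<open>A null function would pair to 0 with \<open>q\<close>, whereas the pairing is
      \<open>s * I\<close>, a nonzero number.\<close>
    show "\<not> zero_on_curve \<gamma> w'"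
      using zero_on_curve_imp_inner_curve_0[of \<gamma> w' q] inner s k I by auto
    have pos: "0 < 2 * (k * (C * W_norm \<gamma> w)) * Q_norm \<gamma> q"
      using k W Q \<open>C > 0\<close> by simp
    have "W_norm \<gamma> w' = k * W_norm \<gamma> (P w)"
      using W_norm_scaleR[OF Pw(2), of s] s by (simp add: w'_def[abs_def])
    also have "\<dots> \<le> k * (C * W_norm \<gamma> w)"
      unfolding C_def using k by (intro mult_left_mono is_L2_projection_W_norm_le[OF P] w stable) auto
    finally have le: "N + W_norm \<gamma> w' \<le> 2 * (k * (C * W_norm \<gamma> w))"
      using k by simp
    have "\<not> zero_on_curve \<gamma> w'" "w' \<in> W \<gamma>"
      by fact (use \<open>w' \<in> S\<close> P in blast)
    then have "0 < (N + W_norm \<gamma> w') * Q_norm \<gamma> q"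
      using W_norm_pos N Q by (simp add: add_nonneg_pos)
    \<comment> \<open>One factor 1/2 comes from near attainment of the dual norm, the other from the
      doubled denominator, and 1 / \<open>C\<close> from the stability of the projection;
      \<open>k\<close> cancels.\<close>
    have "1 / (4 * C) = k * (Q_norm \<gamma> q / 2 * W_norm \<gamma> w) / (2 * (k * (C * W_norm \<gamma> w)) * Q_norm \<gamma> q)"
      using k W Q \<open>C > 0\<close> by (simp add: field_simps)
    also have "\<dots> \<le> k * \<bar>I\<bar> / (2 * (k * (C * W_norm \<gamma> w)) * Q_norm \<gamma> q)"
      using pos k almost by (intro divide_right_mono mult_left_mono) (auto simp: I_def)
    also have "\<dots> \<le> k * \<bar>I\<bar> / ((N + W_norm \<gamma> w') * Q_norm \<gamma> q)"
      using pos k le Q \<open>0 < (N + W_norm \<gamma> w') * Q_norm \<gamma> q\<close>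
      by (intro divide_left_mono mult_right_mono mult_pos_pos[of _ "_ * _"]) auto
    also have "k * \<bar>I\<bar> = inner_curve \<gamma> q (\<lambda>x. - w' x)"
      using inner_curve_scaleR[of \<gamma> q "- 1" w'] inner s by simp
    finally show "1 / (4 * max 1 c) \<le> inner_curve \<gamma> q (\<lambda>x. - w' x) / ((N + W_norm \<gamma> w') * Q_norm \<gamma> q)"
      by (simp add: C_def)
  qed
qed

theorem proposition7:
  fixes \<Omega> :: "vec3 set" and a :: real and p\<^sub>0 p\<^sub>1 :: vec3 and \<Phi> :: "vec3 \<Rightarrow> vec3"
    and \<gamma> :: "real \<Rightarrow> vec3" and H :: "real set"
    and K\<^sub>\<Omega> :: "vec3 set" and T\<^sub>\<Omega> :: "real \<Rightarrow> (vec3 \<Rightarrow> vec3) set" and P\<^sub>\<Omega> :: "(vec3 \<Rightarrow> vec3) set"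
    and K\<^sub>\<Gamma> :: "real set" and T\<^sub>\<Gamma> :: "real \<Rightarrow> (real \<Rightarrow> vec3) set" and P\<^sub>\<Gamma> :: "(real \<Rightarrow> vec3) set"
    and Vh Wh :: "real \<Rightarrow> (vec3 \<Rightarrow> vec3) set"
    and P\<^sub>W :: "real \<Rightarrow> (vec3 \<Rightarrow> vec3) \<Rightarrow> (vec3 \<Rightarrow> vec3)" and c\<^sub>W :: real
  assumes domain: "\<Omega> \<noteq> {}" "connected \<Omega>" "bounded \<Omega>" "lipschitz_domain \<Omega>"
    and fiber: "fiber_geometry \<Omega> a p\<^sub>0 p\<^sub>1 \<Phi> \<gamma>"
    and averaging: "averaging_bounded \<gamma> a"
    and meshes: "regular_mesh_family K\<^sub>\<Omega> (closure \<Omega>) H T\<^sub>\<Omega>"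
      "regular_mesh_family K\<^sub>\<Gamma> (closure (curve \<gamma>)) H T\<^sub>\<Gamma>"
    and size: "\<forall>h\<in>H. h = mesh_size K\<^sub>\<Omega> (T\<^sub>\<Omega> h) K\<^sub>\<Gamma> (T\<^sub>\<Gamma> h)"
    and local_spaces: "polynomial_space P\<^sub>\<Omega>" "polynomial_space P\<^sub>\<Gamma>"
    and Vh: "\<forall>h\<in>H. fe_space (V \<Omega>) K\<^sub>\<Omega> (T\<^sub>\<Omega> h) P\<^sub>\<Omega> (Vh h)"
    and Wh: "\<forall>h\<in>H. fe_space (W \<gamma>) K\<^sub>\<Gamma> (T\<^sub>\<Gamma> h) P\<^sub>\<Gamma> (Wh h)"
    and projection: "\<forall>h\<in>H. is_L2_projection \<gamma> (Wh h) (P\<^sub>W h)"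
    and stable: "c\<^sub>W > 0"
      "\<forall>h\<in>H. \<forall>w\<in>W \<gamma>. tangential_gradient_norm \<gamma> (P\<^sub>W h w) \<le> c\<^sub>W * tangential_gradient_norm \<gamma> w"
  shows "\<exists>\<alpha>\<^sub>7>0. \<forall>h\<in>H.
    (INF q\<^sub>h \<in> {q \<in> Wh h. \<not> zero_on_curve \<gamma> q}.
      SUP (v\<^sub>h, w\<^sub>h) \<in> {(v, w). v \<in> Vh h \<and> w \<in> Wh h \<and> \<not> (zero_on_domain \<Omega> v \<and> zero_on_curve \<gamma> w)}.
        ereal (inner_curve \<gamma> q\<^sub>h (\<lambda>x. averaging \<gamma> a v\<^sub>h x - w\<^sub>h x) /
               ((H1_norm \<Omega> v\<^sub>h + W_norm \<gamma> w\<^sub>h) * Q_norm \<gamma> q\<^sub>h))) \<ge> ereal \<alpha>\<^sub>7"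
proof (intro exI conjI ballI)
  \<comment> \<open>This fixes the witness for \<open>\<alpha>\<^sub>7\<close> before
    \<open>h\<close> is introduced. It depends on \<open>c\<^sub>W\<close> alone, hence is uniform
    in \<open>h\<close>.\<close>
  show "1 / (4 * max 1 c\<^sub>W) > 0"
    by simp
  obtain B where "bounded_speed_curve \<gamma> B"
    using fiber_geometry_bounded_speed[OF fiber] .
  then interpret bounded_speed_curve \<gamma> B .
  fix h assume h: "h \<in> H"
  let ?N = "H1_norm \<Omega> (\<lambda>_. 0)"
  have S: "function_subspace (Wh h)" "Wh h \<subseteq> W \<gamma>" and zero: "(\<lambda>_. 0) \<in> Vh h"
    using Wh Vh h by (auto simp: fe_space_def function_subspace_def)
  have P: "is_L2_projection \<gamma> (Wh h) (P\<^sub>W h)"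
    using projection h by blast
  \<comment> \<open>The extrema are taken in \<open>ereal\<close>: if \<open>Wh h\<close> contains
    only null elements, the infimum is over the empty set and equals infinity, so the bound
    persists.\<close>
  show "ereal (1 / (4 * max 1 c\<^sub>W)) \<le> (INF q\<^sub>h \<in> {q \<in> Wh h. \<not> zero_on_curve \<gamma> q}.
      SUP (v\<^sub>h, w\<^sub>h) \<in> {(v, w). v \<in> Vh h \<and> w \<in> Wh h \<and> \<not> (zero_on_domain \<Omega> v \<and> zero_on_curve \<gamma> w)}.
        ereal (inner_curve \<gamma> q\<^sub>h (\<lambda>x. averaging \<gamma> a v\<^sub>h x - w\<^sub>h x) /
               ((H1_norm \<Omega> v\<^sub>h + W_norm \<gamma> w\<^sub>h) * Q_norm \<gamma> q\<^sub>h)))"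
  proof (rule INF_greatest)
    fix q assume "q \<in> {q \<in> Wh h. \<not> zero_on_curve \<gamma> q}"
    then obtain w where w: "w \<in> Wh h" "\<not> zero_on_curve \<gamma> w"
      "1 / (4 * max 1 c\<^sub>W) \<le> inner_curve \<gamma> q (\<lambda>x. - w x) / ((?N + W_norm \<gamma> w) * Q_norm \<gamma> q)"
      using discrete_inf_sup_witness[OF P S(2,1), of c\<^sub>W q ?N] stable(2) h H1_norm_nonneg by blast
    show "ereal (1 / (4 * max 1 c\<^sub>W)) \<le>
      (SUP (v\<^sub>h, w\<^sub>h) \<in> {(v, w). v \<in> Vh h \<and> w \<in> Wh h \<and> \<not> (zero_on_domain \<Omega> v \<and> zero_on_curve \<gamma> w)}.
        ereal (inner_curve \<gamma> q (\<lambda>x. averaging \<gamma> a v\<^sub>h x - w\<^sub>h x) /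
               ((H1_norm \<Omega> v\<^sub>h + W_norm \<gamma> w\<^sub>h) * Q_norm \<gamma> q)))"
      \<comment> \<open>The pair with zero first component is admissible because \<open>w\<close> is
        not null on the curve; the average of 0 vanishes, leaving the pairing of \<open>q\<close>
        with the negative of \<open>w\<close>.\<close>
      by (rule SUP_upper2[where i="(\<lambda>_. 0, w)"]) (use w zero in \<open>auto simp: averaging_zero\<close>)
  qed
qed

end
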